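(* Let $\Lambda\subset\mathbb{R}^n$ be a full-rank lattice with $\operatorname{vol}(\Lambda)=1$, and let $\Lambda^\star$ be its dual. Then $\Xi_\Lambda(\tau)=\Xi_\Lambda(1/\tau)$ for all $\tau>0$ (i.e., $\tau_0=1$ is a symmetry point of the secrecy function, so that $\Lambda$ achieves its weak secrecy gain at $\tau=1$) if and only if $\Lambda$ is formally unimodular, i.e., $\Theta_\Lambda=\Theta_{\Lambda^\star}$.
   Context: For a full-rank lattice $\Lambda=\{\mathbf{u}\mathsf{G}:\mathbf{u}\in\mathbb{Z}^n\}$, $\operatorname{vol}(\Lambda)=|\det\mathsf{G}|$ and the dual lattice $\Lambda^\star$ is generated by $(\mathsf{G}^{-1})^T$. The theta series is $\Theta_\Lambda(z)=\sum_{\boldsymbol{\lambda}\in\Lambda} e^{i\pi z\|\boldsymbol{\lambda}\|^2}$ for $\operatorname{Im} z>0$. If $\operatorname{vol}(\Lambda)=\nu^n$, the secrecy function is $\Xi_\Lambda(\tau)=\Theta_{\nu\mathbb{Z}^n}(i\tau)/\Theta_\Lambda(i\tau)$, $\tau>0$. A point $\tau_0$ is a symmetry point if $\Xi_\Lambda(\tau_0\tau)=\Xi_\Lambda(\tau_0/\tau)$ for all $\tau>0$; the weak secrecy gain is then $\Xi_\Lambda(\tau_0)$. $\Lambda$ is formally unimodular if $\Theta_\Lambda=\Theta_{\Lambda^\star}$. *)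

theory Defs
  imports "HOL-Analysis.Analysis"
begin

definition lattice :: "real^'n^'n \<Rightarrow> (real^'n) set" where
  "lattice G = {u v* G | u. \<forall>i. u $ i \<in> \<int>}"

definition dual_gen :: "real^'n^'n \<Rightarrow> real^'n^'n" where
  "dual_gen G = transpose (matrix_inv G)"

definition vol :: "real^'n^'n \<Rightarrow> real" where
  "vol G = \<bar>det G\<bar>"

text \<open>Theta series, meaningful for Im z > 0.\<close>
definition theta :: "(real^'n) set \<Rightarrow> complex \<Rightarrow> complex" where
  "theta L z = (\<Sum>\<^sub>\<infinity>x\<in>L. exp (\<i> * complex_of_real pi * z * complex_of_real ((norm x)^2)))"

definition secrecy :: "real^'n^'n \<Rightarrow> real \<Rightarrow> complex" where
  "secrecy G \<tau> =
     (let \<nu> = vol G powr (1 / real CARD('n)) in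
      theta (lattice (\<nu> *\<^sub>R (mat 1 :: real^'n^'n))) (\<i> * complex_of_real \<tau>)
      / theta (lattice G) (\<i> * complex_of_real \<tau>))"

definition formally_unimodular :: "real^'n^'n \<Rightarrow> bool" where
  "formally_unimodular G \<longleftrightarrow>
     (\<forall>z. Im z > 0 \<longrightarrow> theta (lattice G) z = theta (lattice (dual_gen G)) z)"

end

theory Submission
  imports Defs "HOL-Probability.Characteristic_Functions" "HOL-Complex_Analysis.Conformal_Mappings"
    "HOL-Real_Asymp.Real_Asymp"
begin

text \<open>
  Jacobi's identity \<open>\<Theta>\<^sub>\<Lambda>(i t) = C t\<^sup>-\<^sup>n\<^sup>/\<^sup>2 \<Theta>\<^sub>\<Lambda>\<^sub>*(i / t)\<close>, together with its instance \<open>C = 1\<close> for the self-dual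
  lattice of integer points, gives \<open>\<Xi>(1 / t) = \<Theta>\<^sub>Z(i t) / (C \<Theta>\<^sub>\<Lambda>\<^sub>*(i t))\<close>. So the symmetry of \<open>\<Xi>\<close> says that
  \<open>\<Theta>\<^sub>\<Lambda> = C \<Theta>\<^sub>\<Lambda>\<^sub>*\<close> on the imaginary axis. Both theta series tend to 1 at infinity, which forces \<open>C = 1\<close>, and
  the identity theorem extends the equality to the upper half plane. Conversely, if the theta series
  agree then Jacobi's identity at \<open>t = 1\<close> gives \<open>C = 1\<close>.

  Jacobi's identity is obtained by induction on the dimension: the sum over one coordinate is
  transformed by one-dimensional Poisson summation, and the others are projected to the orthogonal
  complement of the corresponding basis vector.
\<close>

section \<open>Poisson summation on the real line\<close>

text \<open>Serves as the uniqueness step of Poisson summation. The unit interval is centred at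
  \<open>p\<close>, so the kernel used below has its only maximum on it at the point in
  question.\<close>

lemma vanishing_fourier_coeffs_imp_zero:
  fixes g :: "real \<Rightarrow> complex" and p :: real
  defines "S \<equiv> {p - 1/2..p + 1/2}"
  assumes cont: "continuous_on S g"
    and coeff: "\<And>n::int. integral S (\<lambda>x. g x * cis (2 * pi * of_int n * x)) = 0"
  shows "g p = 0"
proof (rule ccontr)
  assume nz: "g p \<noteq> 0"
  \<comment> \<open>\<open>K ^ N\<close> is a trigonometric polynomial that concentrates at \<open>p\<close> as \<open>N\<close> grows, so the vanishing
    integral of \<open>g * K ^ N\<close> contradicts \<open>g p \<noteq> 0\<close>.\<close>
  define K where "K x = (cos (pi * (x - p)))\<^sup>2" for x
  have contK: "continuous_on A K" for A
    unfolding K_def by (intro continuous_intros)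
  \<comment> \<open>As a trigonometric polynomial of degree one, \<open>K\<close> shifts frequencies
    by at most one. Hence the coefficients of \<open>g * K ^ N\<close> vanish by induction on
    \<open>N\<close>, for all frequencies simultaneously.\<close>
  have K_cis: "complex_of_real (K x) =
      (2 + cis (- 2 * pi * p) * cis (2 * pi * x) + cis (2 * pi * p) * cis (- 2 * pi * x)) / 4" for x
  proof -
    have "K x = (1 + cos (2 * (pi * (x - p)))) / 2"
      unfolding K_def cos_double_cos by simp
    then show ?thesis
      by (simp add: complex_eq_iff cis_mult algebra_simps)
        (simp add: cos_diff sin_diff algebra_simps)
  qed
  have vanish: "integral S (\<lambda>x. g x * of_real (K x ^ N) * cis (2 * pi * of_int n * x)) = 0" for N and n :: int
  proof (induction N arbitrary: n)
    case 0
    then show ?case using coeff by simp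
  next
    case (Suc N)
    let ?I = "\<lambda>n::int. \<lambda>x. g x * of_real (K x ^ N) * cis (2 * pi * of_int n * x)"
    have int: "?I n integrable_on S" for n
      unfolding S_def
      by (intro integrable_continuous_real continuous_intros cont[unfolded S_def] contK)
    have "g x * of_real (K x ^ Suc N) * cis (2 * pi * of_int n * x) =
       (1/2) * ?I n x + (cis (- 2 * pi * p) / 4) * ?I (n + 1) x + (cis (2 * pi * p) / 4) * ?I (n - 1) x" for x
    proof -
      have 1: "cis (2 * pi * of_int (n + 1) * x) = cis (2 * pi * of_int n * x) * cis (2 * pi * x)"
        "cis (2 * pi * of_int (n - 1) * x) = cis (2 * pi * of_int n * x) * cis (- 2 * pi * x)"
        by (simp_all add: cis_mult algebra_simps)
      show ?thesis
        unfolding 1 power_Suc of_real_mult K_cis by (simp add: algebra_simps add_divide_distrib)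
    qed
    moreover have 0: "(?I n has_integral 0) S" for n
      using int[of n] Suc.IH[of n] by (simp add: has_integral_iff)
    have "((\<lambda>x. (1/2) * ?I n x + (cis (- 2 * pi * p) / 4) * ?I (n + 1) x
        + (cis (2 * pi * p) / 4) * ?I (n - 1) x) has_integral (1/2) * 0 + (cis (- 2 * pi * p) / 4) * 0
        + (cis (2 * pi * p) / 4) * 0) S"
      by (intro has_integral_add has_integral_mult_right 0)
    ultimately show ?case
      by (simp only: mult_zero_right add_0_right integral_unique)
  qed
  \<comment> \<open>Pairing with \<open>cnj (g p)\<close> leaves a real function whose value at
    \<open>p\<close> is the positive number \<open>(norm (g p))^2\<close>.\<close>
  define h where "h x = Re (g x * cnj (g p))" for x
  have conth: "continuous_on S h"
    unfolding h_def by (intro continuous_intros cont)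
  have hK_int: "(\<lambda>x. h x * K x ^ N) integrable_on A" if "A \<subseteq> S" "A = {u..v}" for N A u v
    unfolding that by (intro integrable_continuous_real continuous_intros contK)
      (use conth that in \<open>auto intro: continuous_on_subset\<close>)
  have hK: "integral S (\<lambda>x. h x * K x ^ N) = 0" for N
  proof -
    have i: "(\<lambda>x. g x * of_real (K x ^ N)) integrable_on S"
      unfolding S_def
      by (intro integrable_continuous_real continuous_intros cont[unfolded S_def] contK)
    have "((\<lambda>x. g x * of_real (K x ^ N)) has_integral 0) S"
      using vanish[of N 0] i by (simp add: has_integral_iff)
    from has_integral_linear[OF has_integral_mult_left[OF this, of "cnj (g p)"] bounded_linear_Re]
    have "((\<lambda>x. Re (g x * of_real (K x ^ N) * cnj (g p))) has_integral 0) S"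
      by (simp add: o_def)
    also have "(\<lambda>x. Re (g x * of_real (K x ^ N) * cnj (g p))) = (\<lambda>x. h x * K x ^ N)"
      by (auto simp: h_def algebra_simps simp del: of_real_power)
    finally show ?thesis by (simp add: has_integral_iff)
  qed
  define r where "r = h p"
  have r: "r > 0"
    using nz unfolding r_def h_def by (auto simp: complex_neq_0 power2_eq_square)
  have pS: "p \<in> S" by (simp add: S_def)
  obtain d0 where d0: "d0 > 0" "\<And>x. x \<in> S \<Longrightarrow> dist x p < d0 \<Longrightarrow> dist (h x) (h p) < r / 2"
    using conth pS r unfolding continuous_on_iff by (meson half_gt_zero)
  define d where "d = min (d0 / 2) (1 / 4)"
  have d: "0 < d" "d < d0" "d \<le> 1 / 4" using d0(1) by (auto simp: d_def)
  have h_near: "h x \<ge> r / 2" if "\<bar>x - p\<bar> \<le> d" for x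
  proof -
    have "x \<in> S" "dist x p < d0" using that d by (auto simp: S_def dist_real_def)
    from d0(2)[OF this] show ?thesis by (simp add: dist_real_def r_def abs_if split: if_splits)
  qed
  obtain B where B: "B > 0" "\<And>x. x \<in> S \<Longrightarrow> \<bar>h x\<bar> \<le> B"
    using compact_continuous_image[OF conth] compact_imp_bounded[of "h ` S"]
    unfolding S_def bounded_pos by auto
  \<comment> \<open>Two radii are used: \<open>q\<close> bounds \<open>K\<close> above outside
    distance \<open>d\<close>, while \<open>s\<close> bounds it below within \<open>d / 2\<close>.
    The gap \<open>q < s\<close> is what makes the powers concentrate.\<close>
  define q s where "q = (cos (pi * d))\<^sup>2" and "s = (cos (pi * (d / 2)))\<^sup>2"
  have cos_pos: "0 < cos (pi * u)" if "0 \<le> u" "u \<le> 1/4" for u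
    using that by (intro cos_gt_zero_pi) (auto intro: less_le_trans[of _ 0])
  have K_abs: "K x = (cos (pi * \<bar>x - p\<bar>))\<^sup>2" for x
    using cos_abs_real[of "pi * (x - p)"] by (simp add: K_def abs_mult)
  have mono: "(cos (pi * v))\<^sup>2 \<le> (cos (pi * u))\<^sup>2" if "0 \<le> u" "u \<le> v" "v \<le> 1/2" for u v
    using that by (intro power_mono cos_monotone_0_pi_le cos_ge_zero) (auto intro: order_trans[of _ 0])
  have K_far: "K x \<le> q" if "x \<in> S" "\<bar>x - p\<bar> \<ge> d" for x
    unfolding K_abs q_def using that d by (intro mono) (auto simp: S_def abs_if)
  have K_near: "s \<le> K x" if "\<bar>x - p\<bar> \<le> d / 2" for x
    unfolding K_abs s_def using that d by (intro mono) auto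
  have qs: "0 < q" "q < s" 
    unfolding q_def s_def using d cos_pos[of d]
    by (auto intro!: power_strict_mono cos_monotone_0_pi)
  have K0: "0 \<le> K x" for x by (simp add: K_def)
  have bound: "d * (r / 2) * s ^ N \<le> B * q ^ N" for N
  proof -
    \<comment> \<open>Only points farther than \<open>d\<close> from \<open>p\<close> can make
      \<open>h * K ^ N\<close> negative, and there by at most \<open>B * q ^ N\<close>. Adding this
      constant makes the integrand nonnegative, so shrinking the domain to the inner interval of
      length \<open>d\<close> only decreases the integral.\<close>
    let ?f = "\<lambda>x. h x * K x ^ N + B * q ^ N"
    let ?T = "{p - d/2..p + d/2}"
    have TS: "?T \<subseteq> S" using d by (auto simp: S_def)
    have nonneg: "0 \<le> ?f x" if "x \<in> S" for x
    proof (cases "\<bar>x - p\<bar> \<le> d")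
      case True
      then show ?thesis using h_near[of x] r B qs K0 by (auto intro!: add_nonneg_nonneg mult_nonneg_nonneg)
    next
      case False
      have "\<bar>h x * K x ^ N\<bar> \<le> B * q ^ N"
        unfolding abs_mult using False K_far that B K0 by (intro mult_mono) (auto simp: power_mono)
      then show ?thesis by linarith
    qed
    have "d * (r / 2) * s ^ N = integral ?T (\<lambda>x. (r / 2) * s ^ N)"
      using d by simp
    also have "\<dots> \<le> integral ?T ?f"
    proof (rule integral_le)
      show "(\<lambda>x. (r / 2) * s ^ N) integrable_on ?T" by (rule integrable_const_ivl)
      show "?f integrable_on ?T"
        using hK_int[OF TS refl] by (intro integrable_add) auto
      fix x assume "x \<in> ?T"
      then have "\<bar>x - p\<bar> \<le> d / 2" unfolding atLeastAtMost_iff abs_le_iff by linarith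
      then have "(r / 2) * s ^ N \<le> h x * K x ^ N"
        using h_near[of x] K_near[of x] r qs d by (intro mult_mono power_mono) auto
      moreover have "0 \<le> B * q ^ N" using B qs by simp
      ultimately show "(r / 2) * s ^ N \<le> ?f x" by linarith
    qed
    also have "\<dots> \<le> integral S ?f"
    proof (rule integral_subset_le[OF TS])
      show "?f integrable_on ?T"
        by (intro integrable_add hK_int[OF TS refl] integrable_const_ivl)
      show "?f integrable_on S"
        using hK_int[OF subset_refl S_def[THEN meta_eq_to_obj_eq]] unfolding S_def
        by (intro integrable_add integrable_const_ivl)
    qed (use nonneg in auto)
    also have "\<dots> = integral S (\<lambda>x. h x * K x ^ N) + integral S (\<lambda>x. B * q ^ N)"
      using hK_int[OF subset_refl S_def[THEN meta_eq_to_obj_eq]] unfolding S_def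
      by (intro integral_add integrable_const_ivl)
    also have "\<dots> = B * q ^ N" by (simp add: hK) (simp add: S_def)
    finally show ?thesis .
  qed
  have "(\<lambda>N. B * (q / s) ^ N) \<longlonglongrightarrow> B * 0"
    using qs by (intro tendsto_mult tendsto_const LIMSEQ_power_zero) auto
  moreover have "d * (r / 2) \<le> B * (q / s) ^ N" for N
    using bound[of N] qs by (simp add: power_divide field_simps)
  ultimately have "d * (r / 2) \<le> B * 0"
    by (intro LIMSEQ_le_const) auto
  then show False using d r by (simp add: mult_le_0_iff)
qed

section \<open>Termwise integration, unfolding and Poisson summation\<close>

text \<open>The M-test gives uniform convergence along finite subsets, which preserves continuity
  and commutes with integration over a compact interval.\<close>

lemma
  fixes f :: "'a \<Rightarrow> real \<Rightarrow> complex"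
  assumes bound: "\<And>k x. k \<in> A \<Longrightarrow> x \<in> {a..b} \<Longrightarrow> norm (f k x) \<le> M k"
    and M: "M summable_on A"
    and cont: "\<And>k. continuous_on {a..b} (f k)"
  shows continuous_on_infsum_dominated: "continuous_on {a..b} (\<lambda>x. \<Sum>\<^sub>\<infinity>k\<in>A. f k x)"
    and has_sum_integral_dominated:
      "((\<lambda>k. integral {a..b} (f k)) has_sum integral {a..b} (\<lambda>x. \<Sum>\<^sub>\<infinity>k\<in>A. f k x)) A"
proof -
  have ul: "uniform_limit {a..b} (\<lambda>X x. \<Sum>k\<in>X. f k x) (\<lambda>x. \<Sum>\<^sub>\<infinity>k\<in>A. f k x) (finite_subsets_at_top A)"
    using bound M by (rule Weierstrass_m_test_general)
  show "continuous_on {a..b} (\<lambda>x. \<Sum>\<^sub>\<infinity>k\<in>A. f k x)"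
    by (rule uniform_limit_theorem[OF _ ul]) (auto intro!: always_eventually continuous_intros cont)
  have c: "continuous_on {a..b} (\<lambda>x. \<Sum>k\<in>X. f k x)" for X
    by (intro continuous_intros cont)
  obtain I J where IJ:
    "\<And>X. ((\<lambda>x. \<Sum>k\<in>X. f k x) has_integral I X) {a..b}"
    "((\<lambda>x. \<Sum>\<^sub>\<infinity>k\<in>A. f k x) has_integral J) {a..b}"
    "(I \<longlongrightarrow> J) (finite_subsets_at_top A)"
    by (rule uniform_limit_integral[OF ul c]) auto
  have "(I \<longlongrightarrow> integral {a..b} (\<lambda>x. \<Sum>\<^sub>\<infinity>k\<in>A. f k x)) (finite_subsets_at_top A)"
    using IJ(2,3) by (simp add: integral_unique)
  moreover have "I X = (\<Sum>k\<in>X. integral {a..b} (f k))" if "finite X" for X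
    using integral_unique[OF IJ(1)[of X]] that
    by (simp add: integral_sum cont integrable_continuous_real)
  then have "\<forall>\<^sub>F X in finite_subsets_at_top A. I X = (\<Sum>k\<in>X. integral {a..b} (f k))"
    by (auto simp: eventually_finite_subsets_at_top)
  ultimately show "((\<lambda>k. integral {a..b} (f k)) has_sum integral {a..b} (\<lambda>x. \<Sum>\<^sub>\<infinity>k\<in>A. f k x)) A"
    unfolding has_sum_def by (rule Lim_transform_eventually)
qed

text \<open>Allows an unordered sum over the integers to be evaluated along symmetric partial
  sums.\<close>

lemma filterlim_int_interval_finite_subsets:
  "filterlim (\<lambda>N. {- int N..int N}) (finite_subsets_at_top UNIV) sequentially"
  unfolding filterlim_finite_subsets_at_top
proof (intro allI impI)
  fix X :: "int set"
  assume X: "finite X \<and> X \<subseteq> UNIV"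
  then have b: "\<bar>x\<bar> \<le> Max (abs ` X)" if "x \<in> X" for x
    using that by auto
  show "\<forall>\<^sub>F N in sequentially. finite {- int N..int N} \<and> X \<subseteq> {- int N..int N} \<and> {- int N..int N} \<subseteq> UNIV"
    using eventually_ge_at_top[of "nat (Max (abs ` X))"] by eventually_elim (use b in \<open>force simp: abs_le_iff\<close>)
qed

text \<open>Unit intervals centred at \<open>c + k\<close> tile the line, so symmetric partial sums
  are integrals over growing intervals; dominated convergence gives their limit. Convergence of the
  sum is assumed, and only its value is identified.\<close>

lemma integral_int_translates:
  fixes f :: "real \<Rightarrow> complex"
  assumes int: "integrable lborel f"
    and sum: "((\<lambda>k::int. integral {c - 1/2..c + 1/2} (\<lambda>x. f (x + of_int k))) has_sum s) UNIV"
    and cont: "continuous_on UNIV f"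
  shows "s = (LINT x|lborel. f x)"
proof (rule LIMSEQ_unique)
  let ?S = "\<lambda>N::nat. {c - 1/2 - real N..c + 1/2 + real N}"
  have intble: "f integrable_on {u..v}" for u v
    by (intro integrable_continuous_real continuous_on_subset[OF cont]) auto
  have shift: "integral {c - 1/2..c + 1/2} (\<lambda>x. f (x + t)) = integral {c - 1/2 + t..c + 1/2 + t} f" for t
    using integral_shift[of "c - 1/2" t "c + 1/2" f] continuous_on_subset[OF cont]
    by (simp add: o_def algebra_simps)
  have "(\<Sum>k\<in>{- int N..int N}. integral {c - 1/2..c + 1/2} (\<lambda>x. f (x + of_int k))) = integral (?S N) f" for N
  proof (induction N)
    case 0
    then show ?case by simp
  next
    case (Suc N)
    have split: "{- int (Suc N)..int (Suc N)} = insert (int N + 1) (insert (- int N - 1) {- int N..int N})"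
      by auto
    have "integral (?S (Suc N)) f = integral {c - 1/2 - real (Suc N)..c - 1/2 - real N} f +
        (integral (?S N) f + integral {c + 1/2 + real N..c + 1/2 + real (Suc N)} f)"
      using Henstock_Kurzweil_Integration.integral_combine[where a = "c - 1/2 - real (Suc N)" and c = "c - 1/2 - real N" and b = "c + 1/2 + real (Suc N)", OF _ _ intble]
        Henstock_Kurzweil_Integration.integral_combine[where a = "c - 1/2 - real N" and c = "c + 1/2 + real N" and b = "c + 1/2 + real (Suc N)", OF _ _ intble]
      by simp
    then show ?case
      unfolding split shift using Suc.IH unfolding shift
      by (simp add: algebra_simps)
  qed
  with sum[unfolded has_sum_def, THEN filterlim_compose, OF filterlim_int_interval_finite_subsets]
  show "(\<lambda>N. integral (?S N) f) \<longlonglongrightarrow> s" by simp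
  have "integral (?S N) f = (LINT x|lborel. indicator (?S N) x *\<^sub>R f x)" for N
    using set_borel_integral_eq_integral(2)[of "?S N" f] integrable_mult_indicator[of "?S N" lborel f] int
    by (simp add: set_lebesgue_integral_def set_integrable_def)
  moreover have "(\<lambda>N. LINT x|lborel. indicator (?S N) x *\<^sub>R f x) \<longlonglongrightarrow> (LINT x|lborel. f x)"
  proof (rule integral_dominated_convergence[where w = "\<lambda>x. norm (f x)"])
    show "AE x in lborel. (\<lambda>N. indicator (?S N) x *\<^sub>R f x) \<longlonglongrightarrow> f x"
    proof (intro AE_I2 tendsto_eventually)
      fix x
      show "\<forall>\<^sub>F N in sequentially. indicator (?S N) x *\<^sub>R f x = f x"
        using eventually_ge_at_top[of "nat \<lceil>\<bar>x\<bar> + \<bar>c\<bar> + 1\<rceil>"]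
        by eventually_elim (auto simp: indicator_def, linarith+)
    qed
  qed (use int in \<open>auto simp: indicator_def\<close>)
  ultimately show "(\<lambda>N. integral (?S N) f) \<longlonglongrightarrow> (LINT x|lborel. f x)" by simp
qed

lemma integral_cis_unit_interval:
  fixes j :: int
  shows "integral {c - 1/2..c + 1/2} (\<lambda>x. cis (2 * pi * of_int j * x)) = (if j = 0 then 1 else 0)"
proof (cases "j = 0")
  case False
  let ?F = "\<lambda>x. cis (2 * pi * of_int j * x) / (2 * pi * \<i> * of_int j)"
  have "((\<lambda>x. cis (2 * pi * of_int j * x)) has_integral ?F (c + 1/2) - ?F (c - 1/2)) {c - 1/2..c + 1/2}"
  proof (intro fundamental_theorem_of_calculus)
    fix x :: real
    have "((\<lambda>z. exp (\<i> * (2 * pi * of_int j * z)) / (2 * pi * \<i> * of_int j)) has_field_derivative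
        exp (\<i> * (2 * pi * of_int j * of_real x))) (at (of_real x))"
      using False by (auto intro!: derivative_eq_intros simp: field_simps)
    from has_vector_derivative_real_field[OF this]
    show "(?F has_vector_derivative cis (2 * pi * of_int j * x)) (at x within {c - 1/2..c + 1/2})"
      by (simp add: cis_conv_exp)
  qed simp
  moreover have "cis (2 * pi * of_int j * (c + 1/2)) = cis (2 * pi * of_int j * (c - 1/2)) * cis (2 * pi * of_int j)"
    by (simp add: cis_mult algebra_simps)
  ultimately show ?thesis using False by (simp add: integral_unique cis_multiple_2pi)
qed simp

text \<open>With \<open>c\<close> replaced by a variable, both sides are continuous on the unit
  interval around \<open>c\<close> and have the same Fourier coefficients there. Their difference
  therefore vanishes at the centre.\<close>

theorem poisson_summation:
  fixes \<phi> :: "real \<Rightarrow> complex" and \<psi> :: "int \<Rightarrow> complex"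
  assumes cont: "continuous_on UNIV \<phi>" and int: "integrable lborel \<phi>"
    and M: "M summable_on UNIV"
    and bound: "\<And>x k. x \<in> {c - 1/2..c + 1/2} \<Longrightarrow> norm (\<phi> (x + of_int k)) \<le> M k"
    and \<psi>: "\<And>m. \<psi> m = (LINT x|lborel. \<phi> x * cis (- 2 * pi * of_int m * x))"
    and summable: "(\<lambda>m. norm (\<psi> m)) summable_on UNIV"
  shows "(\<Sum>\<^sub>\<infinity>k. \<phi> (c + of_int k)) = (\<Sum>\<^sub>\<infinity>m. \<psi> m * cis (2 * pi * of_int m * c))"
proof -
  let ?S = "{c - 1/2..c + 1/2}"
  let ?e = "\<lambda>(n::int) x. cis (2 * pi * of_int n * x)"
  define F where "F x = (\<Sum>\<^sub>\<infinity>k::int. \<phi> (x + of_int k))" for x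
  define D where "D x = (\<Sum>\<^sub>\<infinity>m. \<psi> m * ?e m x)" for x
  have contk: "continuous_on X (\<lambda>x. \<phi> (x + of_int k))" for X and k :: int
    by (rule continuous_on_compose2[OF cont]) (auto intro: continuous_intros)
  have contF: "continuous_on ?S F"
    unfolding F_def by (rule continuous_on_infsum_dominated[OF bound M contk]) auto
  have contD: "continuous_on ?S D"
    unfolding D_def by (rule continuous_on_infsum_dominated[OF _ summable])
      (auto simp: norm_mult intro!: continuous_intros)
  have coeffF: "integral ?S (\<lambda>x. F x * ?e n x) = \<psi> (- n)" for n
  proof -
    \<comment> \<open>Periodicity moves the character to the translated argument, so the sum of
      integrals unfolds to one integral over the line.\<close>
    have per: "?e n (x + of_int k) = ?e n x" for x and k :: int
    proof -
      have "?e n (x + of_int k) = ?e n x * cis (2 * pi * of_int (n * k))"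
        by (simp add: cis_mult algebra_simps)
      then show ?thesis by (simp add: cis_multiple_2pi)
    qed
    have "((\<lambda>k::int. integral ?S (\<lambda>x. \<phi> (x + of_int k) * ?e n x)) has_sum
        integral ?S (\<lambda>x. \<Sum>\<^sub>\<infinity>k::int. \<phi> (x + of_int k) * ?e n x)) UNIV"
      by (rule has_sum_integral_dominated[OF _ M]) (auto simp: norm_mult intro!: bound continuous_intros contk)
    also have "(\<lambda>x. \<Sum>\<^sub>\<infinity>k::int. \<phi> (x + of_int k) * ?e n x) = (\<lambda>x. F x * ?e n x)"
      unfolding F_def by (simp add: infsum_cmult_left')
    finally have "((\<lambda>k::int. integral ?S (\<lambda>x. \<phi> (x + of_int k) * ?e n (x + of_int k))) has_sum
        integral ?S (\<lambda>x. F x * ?e n x)) UNIV"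
      by (simp only: per)
    moreover have "integrable lborel (\<lambda>x. \<phi> x * ?e n x)"
      by (rule Bochner_Integration.integrable_bound[OF int]) (auto simp: norm_mult intro!: borel_measurable_continuous_onI continuous_intros cont)
    ultimately have "integral ?S (\<lambda>x. F x * ?e n x) = (LINT x|lborel. \<phi> x * ?e n x)"
      by (intro integral_int_translates[where c = c and f = "\<lambda>x. \<phi> x * ?e n x"])
        (auto intro!: continuous_intros cont)
    also have "\<dots> = \<psi> (- n)" by (simp add: \<psi>)
    finally show ?thesis .
  qed
  have coeffD: "integral ?S (\<lambda>x. D x * ?e n x) = \<psi> (- n)" for n
  proof -
    have "((\<lambda>m. integral ?S (\<lambda>x. \<psi> m * ?e m x * ?e n x)) has_sum
        integral ?S (\<lambda>x. \<Sum>\<^sub>\<infinity>m. \<psi> m * ?e m x * ?e n x)) UNIV"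
      by (rule has_sum_integral_dominated[OF _ summable])
        (auto simp: norm_mult intro!: continuous_intros)
    also have "(\<lambda>x. \<Sum>\<^sub>\<infinity>m. \<psi> m * ?e m x * ?e n x) = (\<lambda>x. D x * ?e n x)"
      unfolding D_def by (simp add: infsum_cmult_left')
    also have "(\<lambda>m. integral ?S (\<lambda>x. \<psi> m * ?e m x * ?e n x)) = (\<lambda>m. if m = - n then \<psi> m else 0)"
    proof
      fix m
      have "(\<lambda>x. \<psi> m * ?e m x * ?e n x) = (\<lambda>x. \<psi> m * ?e (m + n) x)"
        by (simp add: cis_mult algebra_simps)
      then show "integral ?S (\<lambda>x. \<psi> m * ?e m x * ?e n x) = (if m = - n then \<psi> m else 0)"
        using integral_cis_unit_interval[of c "m + n"] by (simp add: eq_neg_iff_add_eq_0)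
    qed
    finally show ?thesis
      by (rule has_sum_unique) (rule has_sum_finite_neutralI[of "{- n}"], auto)
  qed
  have "F c - D c = 0"
  proof (rule vanishing_fourier_coeffs_imp_zero)
    show "continuous_on ?S (\<lambda>x. F x - D x)" by (intro continuous_intros contF contD)
    fix n :: int
    have "(\<lambda>x. F x * ?e n x) integrable_on ?S" "(\<lambda>x. D x * ?e n x) integrable_on ?S"
      by (intro integrable_continuous_real continuous_intros contF contD)+
    then show "integral ?S (\<lambda>x. (F x - D x) * ?e n x) = 0"
      by (simp add: left_diff_distrib integral_diff coeffF coeffD)
  qed
  then show ?thesis by (simp add: F_def D_def)
qed

section \<open>Gaussian sums over the integers\<close>

lemma summable_on_exp_neg_abs_int:
  fixes a :: real
  assumes "a > 0"
  shows "(\<lambda>m::int. exp (- a * \<bar>of_int m\<bar>)) summable_on UNIV"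
proof -
  have nat: "(\<lambda>n::nat. exp (- a) ^ n) summable_on UNIV"
    using assms by (intro norm_summable_imp_summable_on) (auto simp: summable_geometric)
  have "(\<lambda>m::int. exp (- a * \<bar>of_int m\<bar>)) summable_on range int"
    using nat by (subst summable_on_reindex) (auto simp: o_def inj_on_def exp_of_nat_mult[symmetric] mult.commute)
  moreover have "(\<lambda>m::int. exp (- a * \<bar>of_int m\<bar>)) summable_on range (\<lambda>n. - int n)"
    using nat by (subst summable_on_reindex) (auto simp: o_def inj_on_def exp_of_nat_mult[symmetric] mult.commute)
  moreover have "(UNIV :: int set) = range int \<union> range (\<lambda>n. - int n)"
    by (auto intro: int_cases2)
  ultimately show ?thesis using summable_on_union by fastforce
qed

text \<open>Follows from \<open>(x + y)^2 + y^2 = x^2 / 2 + (x + 2 * y)^2 / 2\<close>. Halving the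
  exponent pays for any bounded shift, which yields majorants uniform in \<open>y\<close>.\<close>

lemma gaussian_shift_le:
  fixes a :: real
  assumes "a \<ge> 0" "\<bar>y\<bar> \<le> R"
  shows "exp (- a * (x + y)\<^sup>2) \<le> exp (a * R\<^sup>2) * exp (- (a / 2) * x\<^sup>2)"
proof -
  have "y\<^sup>2 \<le> R\<^sup>2" using assms(2) by (metis abs_ge_zero power2_abs power_mono)
  moreover have "(x + y)\<^sup>2 + y\<^sup>2 = x\<^sup>2 / 2 + (x + 2 * y)\<^sup>2 / 2"
    by (simp add: power2_eq_square field_simps)
  ultimately have "x\<^sup>2 / 2 - R\<^sup>2 \<le> (x + y)\<^sup>2"
    using zero_le_power2[of "x + 2 * y"] by linarith
  then have "a * (x\<^sup>2 / 2 - R\<^sup>2) \<le> a * (x + y)\<^sup>2" using assms(1) by (rule mult_left_mono)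
  then show ?thesis by (simp add: exp_add[symmetric] algebra_simps)
qed

lemma summable_on_gaussian_int:
  fixes a y :: real
  assumes "a > 0"
  shows "(\<lambda>m::int. exp (- a * (of_int m + y)\<^sup>2)) summable_on UNIV"
proof (rule summable_on_comparison_test)
  show "(\<lambda>m::int. exp (a * \<bar>y\<bar>\<^sup>2) * exp (- (a / 2) * \<bar>of_int m\<bar>)) summable_on UNIV"
    using assms by (intro summable_on_cmult_right summable_on_exp_neg_abs_int) auto
  fix m :: int
  have "m = 0 \<or> 1 \<le> \<bar>real_of_int m\<bar>" by linarith
  then have "\<bar>real_of_int m\<bar> \<le> (real_of_int m)\<^sup>2"
    using self_le_power[of "\<bar>real_of_int m\<bar>" 2] by auto
  then have "exp (- (a / 2) * (of_int m)\<^sup>2) \<le> exp (- (a / 2) * \<bar>of_int m\<bar>)"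
    using assms by simp
  then show "exp (- a * (of_int m + y)\<^sup>2) \<le> exp (a * \<bar>y\<bar>\<^sup>2) * exp (- (a / 2) * \<bar>of_int m\<bar>)"
    using gaussian_shift_le[of a y "\<bar>y\<bar>" "of_int m"] assms
    by (smt (verit) exp_gt_zero mult_left_mono)
qed auto

lemma
  fixes a t :: real
  assumes a: "a > 0"
  shows integrable_gaussian_cis:
      "integrable lborel (\<lambda>x. of_real (exp (- (pi / a) * x\<^sup>2)) * cis (t * x))"
    and integral_gaussian_cis:
      "(LINT x|lborel. of_real (exp (- (pi / a) * x\<^sup>2)) * cis (t * x)) =
        of_real (sqrt a * exp (- a * t\<^sup>2 / (4 * pi)))"
proof -
  \<comment> \<open>This is the standard deviation of the centred normal law with density
    proportional to the given Gaussian. Rescaling by it reduces the integral to the characteristic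
    function of the standard normal law.\<close>
  define s where "s = sqrt (a / (2 * pi))"
  have s: "s > 0" "s\<^sup>2 = a / (2 * pi)" using a by (auto simp: s_def)
  have dens: "exp (- (pi / a) * x\<^sup>2) = sqrt a * normal_density 0 s x" for x
    unfolding normal_density_def s using a by (simp add: field_simps)
  have "integrable lborel (\<lambda>x. exp (- (pi / a) * x\<^sup>2))"
    unfolding dens using s by (intro integrable_mult_right) auto
  then show "integrable lborel (\<lambda>x. of_real (exp (- (pi / a) * x\<^sup>2)) * cis (t * x))"
    by (rule Bochner_Integration.integrable_bound)
      (use a in \<open>auto simp: norm_mult intro!: borel_measurable_continuous_onI continuous_intros\<close>)
  have std: "of_real (exp (- (pi / a) * (0 + s * x)\<^sup>2)) * cis (t * (0 + s * x)) =
      of_real (sqrt (2 * pi)) * (std_normal_density x *\<^sub>R iexp (t * s * x))" for x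
  proof -
    have 1: "- (pi / a) * (0 + s * x)\<^sup>2 = - x\<^sup>2 / 2"
      using a by (simp add: power_mult_distrib s(2))
    have 2: "exp (- x\<^sup>2 / 2) = sqrt (2 * pi) * std_normal_density x"
      by (simp add: std_normal_density_def)
    have 3: "cis (t * (0 + s * x)) = iexp (t * s * x)"
      by (simp add: cis_conv_exp mult.assoc)
    show ?thesis unfolding 1 2 3 by (simp add: scaleR_conv_of_real)
  qed
  have "(LINT x|lborel. of_real (exp (- (pi / a) * x\<^sup>2)) * cis (t * x)) =
      s *\<^sub>R (LINT x|lborel. of_real (exp (- (pi / a) * (0 + s * x)\<^sup>2)) * cis (t * (0 + s * x)))"
    using lborel_integral_real_affine[of s "\<lambda>x. of_real (exp (- (pi / a) * x\<^sup>2)) * cis (t * x)" 0] s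
    by simp
  also have "\<dots> = of_real (s * sqrt (2 * pi)) * (LINT x|lborel. std_normal_density x *\<^sub>R iexp (t * s * x))"
    unfolding std by (simp add: scaleR_conv_of_real)
  also have "(LINT x|lborel. std_normal_density x *\<^sub>R iexp (t * s * x)) = char std_normal_distribution (t * s)"
    unfolding char_def by (subst integral_density) auto
  also have "\<dots> = exp (- ((t * s)\<^sup>2) / 2)"
    by (simp add: char_std_normal_distribution)
  also have "- ((t * s)\<^sup>2) / 2 = - a * t\<^sup>2 / (4 * pi)"
    by (simp add: power_mult_distrib s(2))
  also have "s * sqrt (2 * pi) = sqrt a"
    by (simp add: s_def flip: real_sqrt_mult)
  finally show "(LINT x|lborel. of_real (exp (- (pi / a) * x\<^sup>2)) * cis (t * x)) =
        of_real (sqrt a * exp (- a * t\<^sup>2 / (4 * pi)))"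
    by simp
qed

text \<open>The shift \<open>y\<close> turns into a character and the character \<open>c\<close>
  into a shift. Both parameters are needed when this is applied to one coordinate of a lattice
  sum.\<close>

lemma poisson_summation_gaussian:
  fixes a c y :: real
  assumes a: "a > 0"
  shows "(\<Sum>\<^sub>\<infinity>m::int. of_real (exp (- (pi * a) * (of_int m + y)\<^sup>2)) * cis (2 * pi * of_int m * c)) =
    of_real (1 / sqrt a) *
      (\<Sum>\<^sub>\<infinity>k::int. of_real (exp (- (pi / a) * (of_int k + c)\<^sup>2)) * cis (- 2 * pi * y * (of_int k + c)))"
proof -
  \<comment> \<open>Poisson summation is applied starting from the right-hand sum:
    \<open>?\<phi>\<close> gives its terms, and the transform \<open>?\<psi>\<close> gives those of
    the left-hand sum up to \<open>sqrt a\<close>.\<close>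
  let ?\<phi> = "\<lambda>x. of_real (exp (- (pi / a) * x\<^sup>2)) * cis (- 2 * pi * y * x)"
  let ?\<psi> = "\<lambda>m::int. complex_of_real (sqrt a * exp (- (pi * a) * (of_int m + y)\<^sup>2))"
  define R where "R = \<bar>c\<bar> + 1"
  have "(\<Sum>\<^sub>\<infinity>k::int. ?\<phi> (c + of_int k)) = (\<Sum>\<^sub>\<infinity>m. ?\<psi> m * cis (2 * pi * of_int m * c))"
  proof (rule poisson_summation)
    show "continuous_on UNIV ?\<phi>" by (intro continuous_intros)
    show "integrable lborel ?\<phi>"
      using integrable_gaussian_cis[OF a] .
    show "(\<lambda>k::int. exp (pi / a * R\<^sup>2) * exp (- (pi / a / 2) * (of_int k)\<^sup>2)) summable_on UNIV"
      using summable_on_gaussian_int[of "pi / a / 2" 0] a by (intro summable_on_cmult_right) auto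
    show "norm (?\<phi> (x + of_int k)) \<le> exp (pi / a * R\<^sup>2) * exp (- (pi / a / 2) * (of_int k)\<^sup>2)"
      if "x \<in> {c - 1/2..c + 1/2}" for x k
    proof -
      have "\<bar>x\<bar> \<le> R" using that by (auto simp: R_def abs_if)
      from gaussian_shift_le[OF _ this, of "pi / a" "of_int k"] a
      show ?thesis by (simp add: norm_mult add.commute)
    qed
    show "?\<psi> m = (LINT x|lborel. ?\<phi> x * cis (- 2 * pi * of_int m * x))" for m
    proof -
      have "(\<lambda>x. ?\<phi> x * cis (- 2 * pi * of_int m * x)) =
          (\<lambda>x. of_real (exp (- (pi / a) * x\<^sup>2)) * cis ((- 2 * pi * (of_int m + y)) * x))"
      proof
        fix x
        have "cis ((- 2 * pi * (of_int m + y)) * x) = cis (- 2 * pi * y * x) * cis (- 2 * pi * of_int m * x)"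
          by (simp add: cis_mult algebra_simps)
        then show "?\<phi> x * cis (- 2 * pi * of_int m * x) =
            of_real (exp (- (pi / a) * x\<^sup>2)) * cis ((- 2 * pi * (of_int m + y)) * x)"
          by (simp only: mult.assoc)
      qed
      moreover have "- a * (- 2 * pi * (of_int m + y))\<^sup>2 / (4 * pi) = - (pi * a) * (of_int m + y)\<^sup>2"
        by (simp add: power2_eq_square)
      ultimately show ?thesis by (simp only: integral_gaussian_cis[OF a])
    qed
    show "(\<lambda>m. norm (?\<psi> m)) summable_on UNIV"
      using summable_on_cmult_right[OF summable_on_gaussian_int[of "pi * a" y], of "sqrt a"] a
      by (simp add: norm_mult)
  qed
  also have "\<dots> = of_real (sqrt a) * 
      (\<Sum>\<^sub>\<infinity>m::int. of_real (exp (- (pi * a) * (of_int m + y)\<^sup>2)) * cis (2 * pi * of_int m * c))"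
    by (simp add: mult.assoc infsum_cmult_right')
  finally show ?thesis using a by (simp add: add.commute field_simps)
qed

section \<open>Gaussian sums over lattices\<close>

lemma PiE_insert_image:
  "Pi\<^sub>E (insert j I) B = (\<lambda>(u, m). u(j := m)) ` (Pi\<^sub>E I B \<times> B j)"
  unfolding PiE_insert_eq by (subst swap_product [symmetric]) (simp add: image_image case_prod_unfold)

lemma summable_on_PiE_insert:
  assumes "j \<notin> I"
  shows "F summable_on Pi\<^sub>E (insert j I) B \<longleftrightarrow> (\<lambda>(u, m). F (u(j := m))) summable_on (Pi\<^sub>E I B \<times> B j)"
  unfolding PiE_insert_image using inj_combinator'[OF assms]
  by (subst summable_on_reindex) (auto simp: o_def case_prod_unfold)

lemma infsum_PiE_insert:
  fixes F :: "('a \<Rightarrow> 'b) \<Rightarrow> 'c::banach"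
  assumes "j \<notin> I" and summable: "F summable_on Pi\<^sub>E (insert j I) B"
  shows "infsum F (Pi\<^sub>E (insert j I) B) = (\<Sum>\<^sub>\<infinity>u\<in>Pi\<^sub>E I B. \<Sum>\<^sub>\<infinity>m\<in>B j. F (u(j := m)))"
proof -
  have "infsum F (Pi\<^sub>E (insert j I) B) = infsum (\<lambda>(u, m). F (u(j := m))) (Pi\<^sub>E I B \<times> B j)"
    unfolding PiE_insert_image using inj_combinator'[OF assms(1)]
    by (subst infsum_reindex) (auto simp: o_def case_prod_unfold)
  then show ?thesis
    using summable by (simp add: summable_on_PiE_insert[OF assms(1)] infsum_Sigma'_banach)
qed

lemma summable_on_product_real:
  fixes f g :: "_ \<Rightarrow> real"
  assumes f: "f summable_on A" "\<And>x. x \<in> A \<Longrightarrow> 0 \<le> f x"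
    and g: "g summable_on B" "\<And>y. y \<in> B \<Longrightarrow> 0 \<le> g y"
  shows "(\<lambda>(x, y). f x * g y) summable_on (A \<times> B)"
proof (rule summable_on_SigmaI)
  show "((\<lambda>y. case (x, y) of (x, y) \<Rightarrow> f x * g y) has_sum f x * infsum g B) B" for x
    using g(1) by (auto intro: has_sum_cmult_right)
  show "(\<lambda>x. f x * infsum g B) summable_on A"
    using f(1) by (rule summable_on_cmult_left)
qed (use f(2) g(2) in auto)

lemma summable_on_prod_PiE:
  fixes f :: "'a \<Rightarrow> 'b \<Rightarrow> real"
  assumes "finite I" and "\<And>i. i \<in> I \<Longrightarrow> f i summable_on B i"
    and "\<And>i x. i \<in> I \<Longrightarrow> x \<in> B i \<Longrightarrow> 0 \<le> f i x"
  shows "(\<lambda>u. \<Prod>i\<in>I. f i (u i)) summable_on Pi\<^sub>E I B"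
  using assms
proof (induction I)
  case (insert j I)
  have eq: "(\<Prod>i\<in>insert j I. f i ((u(j := m)) i)) = (\<Prod>i\<in>I. f i (u i)) * f j m" for u m
  proof -
    have "(\<Prod>i\<in>I. f i ((u(j := m)) i)) = (\<Prod>i\<in>I. f i (u i))"
      using insert.hyps by (intro prod.cong) auto
    then show ?thesis using insert.hyps by simp
  qed
  show ?case
    unfolding summable_on_PiE_insert[OF insert.hyps(2)] eq
    by (rule summable_on_product_real) (use insert in \<open>auto intro!: prod_nonneg simp: PiE_iff\<close>)
qed simp

text \<open>The dual family reads off coordinates, so by Cauchy-Schwarz the squared norm dominates a
  multiple of the sum of squared coordinates. The terms are then bounded by products of
  one-dimensional Gaussians.\<close>

lemma summable_on_lattice_gaussian:
  fixes b d :: "'i \<Rightarrow> 'v::real_inner" and c :: "'i \<Rightarrow> real"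
  assumes I: "finite I" and e: "e > 0"
    and dual: "\<And>i k. i \<in> I \<Longrightarrow> k \<in> I \<Longrightarrow> b i \<bullet> d k = (if i = k then 1 else 0)"
  shows "(\<lambda>u. exp (- e * (norm (\<Sum>i\<in>I. (of_int (u i) + c i) *\<^sub>R b i))\<^sup>2))
    summable_on Pi\<^sub>E I (\<lambda>_. UNIV :: int set)"
proof -
  \<comment> \<open>The added 1 keeps \<open>B\<close> positive even for empty
    \<open>I\<close>.\<close>
  define B where "B = (\<Sum>k\<in>I. (norm (d k))\<^sup>2) + 1"
  have B: "B > 0" by (auto simp: B_def intro!: add_nonneg_pos sum_nonneg)
  let ?v = "\<lambda>u. \<Sum>i\<in>I. (of_int (u i) + c i) *\<^sub>R b i"
  have coord: "?v u \<bullet> d k = of_int (u k) + c k" if "k \<in> I" for u k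
    using that I by (simp add: inner_sum_left dual if_distrib cong: if_cong)
  have "(\<Sum>k\<in>I. (of_int (u k) + c k)\<^sup>2) \<le> (norm (?v u))\<^sup>2 * B" for u
  proof -
    have "(\<Sum>k\<in>I. (of_int (u k) + c k)\<^sup>2) \<le> (\<Sum>k\<in>I. (norm (?v u))\<^sup>2 * (norm (d k))\<^sup>2)"
    proof (rule sum_mono)
      fix k assume k: "k \<in> I"
      have "\<bar>of_int (u k) + c k\<bar> \<le> norm (?v u) * norm (d k)"
        using Cauchy_Schwarz_ineq2[of "?v u" "d k"] coord[OF k, of u] by simp
      then have "\<bar>of_int (u k) + c k\<bar>\<^sup>2 \<le> (norm (?v u) * norm (d k))\<^sup>2"
        by (rule power_mono) simp
      then show "(of_int (u k) + c k)\<^sup>2 \<le> (norm (?v u))\<^sup>2 * (norm (d k))\<^sup>2"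
        by (simp add: power_mult_distrib)
    qed
    also have "\<dots> \<le> (norm (?v u))\<^sup>2 * B"
      unfolding sum_distrib_left[symmetric] B_def by (intro mult_left_mono) auto
    finally show ?thesis .
  qed
  then have le: "exp (- e * (norm (?v u))\<^sup>2) \<le> (\<Prod>k\<in>I. exp (- (e / B) * (of_int (u k) + c k)\<^sup>2))" for u
    using e B by (simp add: exp_sum[OF I, symmetric] sum_negf sum_divide_distrib[symmetric]
        sum_distrib_left[symmetric] divide_le_eq mult.assoc)
  show ?thesis
  proof (rule summable_on_comparison_test[OF _ le])
    show "(\<lambda>u. \<Prod>k\<in>I. exp (- (e / B) * (of_int (u k) + c k)\<^sup>2)) summable_on Pi\<^sub>E I (\<lambda>_. UNIV :: int set)"
      using summable_on_prod_PiE[OF I, of "\<lambda>k m. exp (- (e / B) * (of_int m + c k)\<^sup>2)" "\<lambda>_. UNIV"]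
        summable_on_gaussian_int[of "e / B"] e B by simp
  qed simp
qed

lemma norm_add_scaleR_orthogonal:
  fixes p q :: "'v::real_inner"
  assumes "p \<bullet> q = 0"
  shows "(norm (p + s *\<^sub>R q))\<^sup>2 = (norm p)\<^sup>2 + s\<^sup>2 * (q \<bullet> q)"
  using assms unfolding power2_norm_eq_inner
  by (simp add: inner_add_left inner_add_right inner_commute[of q p] power2_eq_square)

text \<open>The last hypothesis says that \<open>d\<close> lies in the span of \<open>b\<close>, in a form that is stable under
  projecting \<open>b\<close> orthogonally to one of its members.\<close>

theorem poisson_summation_lattice_gaussian:
  fixes b d :: "'i \<Rightarrow> 'v::real_inner"
  assumes "finite I"
    and "\<And>i k. i \<in> I \<Longrightarrow> k \<in> I \<Longrightarrow> b i \<bullet> d k = (if i = k then 1 else 0)"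
    and "\<And>x k. (\<And>i. i \<in> I \<Longrightarrow> x \<bullet> b i = 0) \<Longrightarrow> k \<in> I \<Longrightarrow> x \<bullet> d k = 0"
  shows "\<exists>C>0. \<forall>t>0. \<forall>c :: 'i \<Rightarrow> real.
    (\<Sum>\<^sub>\<infinity>u\<in>Pi\<^sub>E I (\<lambda>_. UNIV :: int set).
      of_real (exp (- (pi * t) * (norm (\<Sum>i\<in>I. of_int (u i) *\<^sub>R b i))\<^sup>2)) *
      cis (2 * pi * (\<Sum>i\<in>I. of_int (u i) * c i))) =
    of_real (C / sqrt t ^ card I) *
    (\<Sum>\<^sub>\<infinity>w\<in>Pi\<^sub>E I (\<lambda>_. UNIV :: int set).
      complex_of_real (exp (- (pi / t) * (norm (\<Sum>i\<in>I. (of_int (w i) + c i) *\<^sub>R d i))\<^sup>2)))"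
  using assms
proof (induction I arbitrary: b)
  case empty
  then show ?case by (intro exI[of _ 1]) simp
next
  case (insert j I)
  note I = \<open>finite I\<close> and j = \<open>j \<notin> I\<close>
  note dual = insert.prems(1) and perp = insert.prems(2)
  let ?Z = "\<lambda>I. Pi\<^sub>E I (\<lambda>_. UNIV :: int set)"
  \<comment> \<open>Dualise the coordinate \<open>j\<close> by one-dimensional Poisson summation; what remains is a Gaussian sum for
    the projections \<open>b'\<close> of the other vectors to the complement of \<open>b j\<close>, whose dual family is
    still \<open>d\<close>, twisted by a character that depends on the new summation index.\<close>
  define a where "a = b j \<bullet> b j"
  have "b j \<noteq> 0" using dual[of j j] by auto
  then have a: "a > 0" by (simp add: a_def)
  define \<alpha> where "\<alpha> i = (b i \<bullet> b j) / a" for i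
  define b' where "b' i = b i - \<alpha> i *\<^sub>R b j" for i
  have b'_j: "b' i \<bullet> b j = 0" for i
    using a by (simp add: b'_def inner_diff_left \<alpha>_def a_def)
  have d_j: "d k \<bullet> b j = 0" if "k \<in> I" for k
    using dual[of j k] that j by (auto simp: inner_commute)
  have dual': "b' i \<bullet> d k = (if i = k then 1 else 0)" if "i \<in> I" "k \<in> I" for i k
    using dual[of i k] dual[of j k] that j by (auto simp: b'_def inner_diff_left)
  have perp': "x \<bullet> d k = 0" if x: "\<And>i. i \<in> I \<Longrightarrow> x \<bullet> b' i = 0" and k: "k \<in> I" for x k
  proof -
    \<comment> \<open>Removing the component of \<open>x\<close> along \<open>b j\<close> makes it
      orthogonal to all original vectors; its product with \<open>d k\<close> is unaffected because
      \<open>d k\<close> is orthogonal to \<open>b j\<close>.\<close>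
    define s where "s = (x \<bullet> b j) / a"
    have "(x - s *\<^sub>R b j) \<bullet> b i = 0" if "i \<in> insert j I" for i
    proof (cases "i = j")
      case True
      then show ?thesis using a by (simp add: inner_diff_left s_def a_def)
    next
      case False
      then have "x \<bullet> b i - \<alpha> i * (x \<bullet> b j) = 0"
        using x[of i] that by (simp add: b'_def inner_diff_right)
      then show ?thesis
        by (simp add: inner_diff_left s_def \<alpha>_def inner_commute[of "b j"] mult.commute)
    qed
    from perp[OF this, of k] k have "(x - s *\<^sub>R b j) \<bullet> d k = 0" by simp
    then show ?thesis using d_j[OF k] by (simp add: inner_diff_left inner_commute[of "b j"])
  qed
  obtain C where C: "C > 0" and IH: "\<And>t c. t > 0 \<Longrightarrow>
    (\<Sum>\<^sub>\<infinity>u\<in>?Z I. of_real (exp (- (pi * t) * (norm (\<Sum>i\<in>I. of_int (u i) *\<^sub>R b' i))\<^sup>2)) *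
      cis (2 * pi * (\<Sum>i\<in>I. of_int (u i) * c i))) =
    of_real (C / sqrt t ^ card I) *
    (\<Sum>\<^sub>\<infinity>w\<in>?Z I. complex_of_real (exp (- (pi / t) * (norm (\<Sum>i\<in>I. (of_int (w i) + c i) *\<^sub>R d i))\<^sup>2)))"
    using insert.IH[OF dual' perp'] by blast
  have dj: "d j = (1 / a) *\<^sub>R b j - (\<Sum>i\<in>I. \<alpha> i *\<^sub>R d i)"
  proof -
    \<comment> \<open>The error \<open>z\<close> is orthogonal to every \<open>b i\<close>, hence by
      \<open>perp\<close> to every \<open>d k\<close>. Being itself a combination of such vectors,
      it is orthogonal to itself.\<close>
    define z where "z = d j - ((1 / a) *\<^sub>R b j - (\<Sum>i\<in>I. \<alpha> i *\<^sub>R d i))"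
    have zb: "z \<bullet> b i = 0" if "i \<in> insert j I" for i
    proof (cases "i = j")
      case True
      have "(\<Sum>i\<in>I. \<alpha> i *\<^sub>R d i) \<bullet> b j = 0"
        by (simp add: inner_sum_left d_j)
      then show ?thesis
        using True dual[of j j] a by (simp add: z_def inner_diff_left inner_commute[of "d j"] a_def)
    next
      case False
      then have i: "i \<in> I" using that by simp
      have "(\<Sum>k\<in>I. \<alpha> k *\<^sub>R d k) \<bullet> b i = (\<Sum>k\<in>I. if k = i then \<alpha> i else 0)"
        unfolding inner_sum_left
        by (rule sum.cong) (use dual i in \<open>auto simp: inner_commute\<close>)
      also have "\<dots> = \<alpha> i" using I i by simp
      finally show ?thesis
        using dual[of i j] i False by (simp add: z_def inner_diff_left inner_commute[of "d j"] inner_commute[of "b j"] \<alpha>_def)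
    qed
    have zd: "z \<bullet> d k = 0" if "k \<in> insert j I" for k
      using perp[OF zb that] by blast
    have "z \<bullet> z = z \<bullet> d j - ((1 / a) * (z \<bullet> b j) - (\<Sum>i\<in>I. \<alpha> i * (z \<bullet> d i)))"
      by (subst (2) z_def) (simp add: inner_diff_right inner_sum_right)
    also have "\<dots> = 0" using zd zb by simp
    finally show ?thesis by (simp add: z_def)
  qed
  \<comment> \<open>The coefficient along \<open>b j\<close> contributed by the other vectors; it
    becomes the shift in the one-dimensional sum over the coordinate \<open>j\<close>.\<close>
  define y where "y u = (\<Sum>i\<in>I. of_int (u i) * \<alpha> i)" for u :: "'i \<Rightarrow> int"
  have upd: "(\<Sum>i\<in>insert j I. f i ((u(j := m)) i)) = f j m + (\<Sum>i\<in>I. f i (u i))"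
    for f :: "'i \<Rightarrow> int \<Rightarrow> 'x::comm_monoid_add" and u m
  proof -
    have "(\<Sum>i\<in>I. f i ((u(j := m)) i)) = (\<Sum>i\<in>I. f i (u i))"
      using j by (intro sum.cong) auto
    then show ?thesis using I j by simp
  qed
  have Q1: "(norm (\<Sum>i\<in>insert j I. of_int ((u(j := m)) i) *\<^sub>R b i))\<^sup>2 =
      (norm (\<Sum>i\<in>I. of_int (u i) *\<^sub>R b' i))\<^sup>2 + (of_int m + y u)\<^sup>2 * a" for u m
  proof -
    have "(\<Sum>i\<in>insert j I. of_int ((u(j := m)) i) *\<^sub>R b i) =
        (\<Sum>i\<in>I. of_int (u i) *\<^sub>R b' i) + (of_int m + y u) *\<^sub>R b j"
      unfolding upd[of "\<lambda>i k. of_int k *\<^sub>R b i"] b'_def y_def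
      by (simp add: scaleR_diff_right sum_subtractf scaleR_left.sum scaleR_add_left)
    moreover have "(\<Sum>i\<in>I. of_int (u i) *\<^sub>R b' i) \<bullet> b j = 0"
      by (simp add: inner_sum_left b'_j)
    ultimately show ?thesis by (simp add: norm_add_scaleR_orthogonal a_def)
  qed
  \<comment> \<open>The dual form splits along the same direction \<open>b j\<close>. Expanding
    \<open>d j\<close> by \<open>dj\<close> shifts the remaining coordinates by an amount depending
    on \<open>k\<close>.\<close>
  have Q2: "(norm (\<Sum>i\<in>insert j I. (of_int ((w(j := k)) i) + c i) *\<^sub>R d i))\<^sup>2 =
      (norm (\<Sum>i\<in>I. (of_int (w i) + (c i - \<alpha> i * (of_int k + c j))) *\<^sub>R d i))\<^sup>2 + (of_int k + c j)\<^sup>2 / a"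
    for w k and c :: "'i \<Rightarrow> real"
  proof -
    have "(\<Sum>i\<in>insert j I. (of_int ((w(j := k)) i) + c i) *\<^sub>R d i) =
        (\<Sum>i\<in>I. (of_int (w i) + (c i - \<alpha> i * (of_int k + c j))) *\<^sub>R d i) + ((of_int k + c j) / a) *\<^sub>R b j"
      unfolding upd[of "\<lambda>i k. (of_int k + c i) *\<^sub>R d i"] dj
      by (simp add: algebra_simps add_divide_distrib sum.distrib sum_subtractf scaleR_right.sum sum_distrib_left)
    moreover have "(\<Sum>i\<in>I. (of_int (w i) + (c i - \<alpha> i * (of_int k + c j))) *\<^sub>R d i) \<bullet> b j = 0"
      by (simp add: inner_sum_left d_j)
    ultimately show ?thesis
      using a by (simp add: norm_add_scaleR_orthogonal flip: a_def) (simp add: power2_eq_square)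
  qed
  \<comment> \<open>The coordinate \<open>j\<close> contributes \<open>1 / sqrt (t * a)\<close>: the
    factor \<open>1 / sqrt a\<close> enters the constant and \<open>1 / sqrt t\<close> raises the
    power.\<close>
  show ?case
  proof (intro exI[of _ "C / sqrt a"] conjI allI impI)
    show "C / sqrt a > 0" using C a by simp
    fix t :: real and c :: "'i \<Rightarrow> real"
    assume t: "t > 0"
    define E where "E u = exp (- (pi * t) * (norm (\<Sum>i\<in>I. of_int (u i) *\<^sub>R b' i))\<^sup>2)" for u :: "'i \<Rightarrow> int"
    define G where "G k = exp (- (pi / (t * a)) * (of_int k + c j)\<^sup>2)" for k :: int
    define c' where "c' k i = c i - \<alpha> i * (of_int k + c j)" for k :: int and i
    define T where "T w k = exp (- (pi / t) * (norm (\<Sum>i\<in>I. (of_int (w i) + c' k i) *\<^sub>R d i))\<^sup>2)" for w k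
    define \<kappa> where "\<kappa> u f = cis (2 * pi * (\<Sum>i\<in>I. of_int (u i) * f i))" for u :: "'i \<Rightarrow> int" and f :: "'i \<Rightarrow> real"
    have E_summable: "E summable_on ?Z I"
      unfolding E_def using summable_on_lattice_gaussian[OF I _ dual', of "pi * t" "\<lambda>_. 0"] t by simp
    have G_summable: "G summable_on UNIV"
      unfolding G_def using t a by (intro summable_on_gaussian_int) auto
    have dual_sym: "d i \<bullet> b k = (if i = k then 1 else 0)" if "i \<in> insert j I" "k \<in> insert j I" for i k
      using dual[OF that(2,1)] by (auto simp: inner_commute)
    let ?F = "\<lambda>u. of_real (exp (- (pi * t) * (norm (\<Sum>i\<in>insert j I. of_int (u i) *\<^sub>R b i))\<^sup>2)) *
      cis (2 * pi * (\<Sum>i\<in>insert j I. of_int (u i) * c i))"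
    let ?R = "\<lambda>w. exp (- (pi / t) * (norm (\<Sum>i\<in>insert j I. (of_int (w i) + c i) *\<^sub>R d i))\<^sup>2)"
    have F_summable: "?F summable_on ?Z (insert j I)"
    proof (rule abs_summable_summable)
      show "(\<lambda>u. norm (?F u)) summable_on ?Z (insert j I)"
        using summable_on_lattice_gaussian[where I = "insert j I" and e = "pi * t" and c = "\<lambda>_. 0", OF _ _ dual] I t
        by (simp add: norm_mult)
    qed
    have R_summable: "?R summable_on ?Z (insert j I)"
      using summable_on_lattice_gaussian[where I = "insert j I" and e = "pi / t" and c = c, OF _ _ dual_sym] I t by simp
    then have R_summable': "(\<lambda>w. complex_of_real (?R w)) summable_on ?Z (insert j I)"
      by (rule summable_on_of_real)
    have F_eq: "?F (u(j := m)) = of_real (E u) * \<kappa> u c *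
        (of_real (exp (- (pi * (t * a)) * (of_int m + y u)\<^sup>2)) * cis (2 * pi * of_int m * c j))" for u m
    proof -
      have "cis (2 * pi * (of_int m * c j + (\<Sum>i\<in>I. of_int (u i) * c i))) =
          \<kappa> u c * cis (2 * pi * of_int m * c j)"
        unfolding \<kappa>_def cis_mult by (simp add: algebra_simps)
      moreover have "exp (- (pi * t) * ((norm (\<Sum>i\<in>I. of_int (u i) *\<^sub>R b' i))\<^sup>2 + (of_int m + y u)\<^sup>2 * a)) =
          E u * exp (- (pi * (t * a)) * (of_int m + y u)\<^sup>2)"
        unfolding E_def by (simp add: algebra_simps flip: exp_add)
      ultimately show ?thesis
        unfolding Q1 upd[of "\<lambda>i k. of_int k * c i"] by (simp only: of_real_mult ac_simps)
    qed
    have R_eq: "?R (w(j := k)) = G k * T w k" for w k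
      unfolding Q2 G_def T_def c'_def using a t by (simp add: algebra_simps add_divide_distrib flip: exp_add)
    \<comment> \<open>The phase produced by the coordinate \<open>j\<close> merges with the old
      character into one depending on \<open>k\<close>. This is why the induction has to allow
      arbitrary \<open>c\<close>.\<close>
    have \<kappa>_eq: "\<kappa> u c * cis (- 2 * pi * y u * (of_int k + c j)) = \<kappa> u (c' k)" for u k
      unfolding \<kappa>_def cis_mult y_def c'_def
      by (simp add: algebra_simps sum_subtractf sum.distrib sum_distrib_left sum_negf)
    have "infsum ?F (?Z (insert j I)) = (\<Sum>\<^sub>\<infinity>u\<in>?Z I. \<Sum>\<^sub>\<infinity>m. ?F (u(j := m)))"
      by (rule infsum_PiE_insert[OF j F_summable])
    also have "\<dots> = (\<Sum>\<^sub>\<infinity>u\<in>?Z I. of_real (E u) * \<kappa> u c * (of_real (1 / sqrt (t * a)) *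
        (\<Sum>\<^sub>\<infinity>k. of_real (G k) * cis (- 2 * pi * y u * (of_int k + c j)))))"
      unfolding F_eq infsum_cmult_right' G_def using t a
      by (subst poisson_summation_gaussian) auto
    also have "\<dots> = of_real (1 / sqrt (t * a)) * (\<Sum>\<^sub>\<infinity>u\<in>?Z I. \<Sum>\<^sub>\<infinity>k.
        of_real (G k) * (of_real (E u) * \<kappa> u (c' k)))"
      unfolding infsum_cmult_right'[symmetric] \<kappa>_eq[symmetric] by (simp only: ac_simps)
    \<comment> \<open>Characters have modulus one, so the summable product \<open>E u * G k\<close>
      justifies the exchange, and the inner sum over \<open>u\<close> has the form of the induction
      hypothesis.\<close>
    also have "(\<Sum>\<^sub>\<infinity>u\<in>?Z I. \<Sum>\<^sub>\<infinity>k. of_real (G k) * (of_real (E u) * \<kappa> u (c' k))) =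
        (\<Sum>\<^sub>\<infinity>k. \<Sum>\<^sub>\<infinity>u\<in>?Z I. of_real (G k) * (of_real (E u) * \<kappa> u (c' k)))"
    proof (rule infsum_swap_banach, rule abs_summable_summable)
      have "(\<lambda>(u, k). E u * G k) summable_on (?Z I \<times> UNIV)"
        by (rule summable_on_product_real[OF E_summable _ G_summable]) (auto simp: E_def G_def)
      moreover have "E u \<ge> 0" "G k \<ge> 0" for u k by (auto simp: E_def G_def)
      ultimately show "(\<lambda>x. norm (case x of (u, k) \<Rightarrow> of_real (G k) * (of_real (E u) * \<kappa> u (c' k))))
          summable_on (?Z I \<times> UNIV)"
        by (simp add: case_prod_unfold norm_mult \<kappa>_def mult.commute)
    qed
    also have "\<dots> = (\<Sum>\<^sub>\<infinity>k. of_real (G k) * (of_real (C / sqrt t ^ card I) * (\<Sum>\<^sub>\<infinity>w\<in>?Z I. of_real (T w k))))"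
      unfolding infsum_cmult_right' E_def \<kappa>_def T_def IH[OF t] ..
    also have "\<dots> = of_real (C / sqrt t ^ card I) * (\<Sum>\<^sub>\<infinity>k. \<Sum>\<^sub>\<infinity>w\<in>?Z I. of_real (?R (w(j := k))))"
      unfolding R_eq of_real_mult infsum_cmult_right'[symmetric] by (simp only: ac_simps)
    also have "(\<Sum>\<^sub>\<infinity>k. \<Sum>\<^sub>\<infinity>w\<in>?Z I. complex_of_real (?R (w(j := k)))) = (\<Sum>\<^sub>\<infinity>w\<in>?Z I. \<Sum>\<^sub>\<infinity>k. of_real (?R (w(j := k))))"
      by (rule infsum_swap_banach[symmetric])
        (rule R_summable'[unfolded summable_on_PiE_insert[OF j]])
    also have "\<dots> = (\<Sum>\<^sub>\<infinity>w\<in>?Z (insert j I). of_real (?R w))"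
      by (rule infsum_PiE_insert[OF j R_summable', symmetric])
    also have "of_real (1 / sqrt (t * a)) * (of_real (C / sqrt t ^ card I) * (\<Sum>\<^sub>\<infinity>w\<in>?Z (insert j I). of_real (?R w))) =
        complex_of_real (C / sqrt a / sqrt t ^ card (insert j I)) * (\<Sum>\<^sub>\<infinity>w\<in>?Z (insert j I). of_real (?R w))"
      using I j by (simp add: real_sqrt_mult)
    finally show "infsum ?F (?Z (insert j I)) =
        of_real (C / sqrt a / sqrt t ^ card (insert j I)) * (\<Sum>\<^sub>\<infinity>w\<in>?Z (insert j I). of_real (?R w))" .
  qed
qed

section \<open>Theta series\<close>

lemma matrix_inv_mult:
  fixes G :: "real^'n^'n"
  assumes "invertible G"
  shows matrix_inv_right_eq: "G ** matrix_inv G = mat 1"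
    and matrix_inv_left_eq: "matrix_inv G ** G = mat 1"
  using someI_ex[OF assms[unfolded invertible_def]] unfolding matrix_inv_def by blast+

lemma invertible_dual_gen:
  assumes "invertible G"
  shows "invertible (dual_gen G)"
  unfolding dual_gen_def invertible_def
  by (intro exI[of _ "transpose G"])
    (simp add: matrix_inv_mult[OF assms] transpose_mat flip: matrix_transpose_mul)

lemma dual_gen_mat_1: "dual_gen (mat 1 :: real^'n^'n) = mat 1"
proof -
  have "invertible (mat 1 :: real^'n^'n)" by (auto simp: invertible_def intro!: exI[of _ "mat 1"])
  from matrix_inv_right_eq[OF this] show ?thesis by (simp add: dual_gen_def transpose_mat)
qed

lemma inner_dual_gen:
  assumes "invertible G"
  shows "G $ i \<bullet> dual_gen G $ k = (if i = k then 1 else 0)"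
proof -
  have "G $ i \<bullet> dual_gen G $ k = (G ** matrix_inv G) $ i $ k"
    by (simp add: dual_gen_def inner_vec_def matrix_matrix_mult_def transpose_def)
  then show ?thesis by (simp add: matrix_inv_right_eq[OF assms] mat_def)
qed

text \<open>Encoding coordinates as integer-valued functions matches the index set of the lattice
  Gaussian sums.\<close>

lemma lattice_eq_range:
  fixes G :: "real^'n^'n"
  shows "lattice G = range (\<lambda>u :: 'n \<Rightarrow> int. \<Sum>i\<in>UNIV. of_int (u i) *\<^sub>R G $ i)"
proof -
  have eq: "u v* G = (\<Sum>i\<in>UNIV. (u $ i) *\<^sub>R G $ i)" for u
    by (simp add: vec_eq_iff vector_matrix_mult_def)
  have int_coords: "\<exists>w :: 'n \<Rightarrow> int. \<forall>i. u $ i = of_int (w i)" if "\<forall>i. u $ i \<in> \<int>" for u :: "real^'n"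
    using that by (intro choice) (auto elim: Ints_cases)
  show ?thesis
  proof (intro equalityI subsetI)
    fix x assume "x \<in> lattice G"
    then obtain u :: "real^'n" where u: "x = (\<Sum>i\<in>UNIV. (u $ i) *\<^sub>R G $ i)" "\<forall>i. u $ i \<in> \<int>"
      unfolding lattice_def eq by blast
    from int_coords[OF u(2)] obtain w :: "'n \<Rightarrow> int" where "\<And>i. u $ i = of_int (w i)" by blast
    then show "x \<in> range (\<lambda>u :: 'n \<Rightarrow> int. \<Sum>i\<in>UNIV. of_int (u i) *\<^sub>R G $ i)"
      using u(1) by auto
  next
    fix x assume "x \<in> range (\<lambda>u :: 'n \<Rightarrow> int. \<Sum>i\<in>UNIV. of_int (u i) *\<^sub>R G $ i)"
    then obtain w :: "'n \<Rightarrow> int" where "x = (\<Sum>i\<in>UNIV. of_int (w i) *\<^sub>R G $ i)" by blast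
    then have "x = (\<chi> i. of_int (w i)) v* G" unfolding eq by simp
    then show "x \<in> lattice G" unfolding lattice_def by (auto intro!: exI[of _ "\<chi> i. of_int (w i)"])
  qed
qed

text \<open>Recovering coordinates this way gives injectivity of the parametrisation and a gap
  around the origin.\<close>

lemma inner_lattice_dual_gen:
  assumes "invertible G"
  shows "(\<Sum>i\<in>UNIV. of_int (u i) *\<^sub>R G $ i) \<bullet> dual_gen G $ k = of_int (u k)"
proof -
  have "(\<Sum>i\<in>UNIV. of_int (u i) *\<^sub>R G $ i) \<bullet> dual_gen G $ k = (\<Sum>i\<in>UNIV. if i = k then of_int (u k) else 0)"
    unfolding inner_sum_left by (rule sum.cong) (auto simp: inner_dual_gen[OF assms])
  then show ?thesis by simp
qed

lemma inj_lattice_param: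
  fixes G :: "real^'n^'n"
  assumes "invertible G"
  shows "inj (\<lambda>u :: 'n \<Rightarrow> int. \<Sum>i\<in>UNIV. of_int (u i) *\<^sub>R G $ i)"
proof (rule injI, rule ext)
  fix u v :: "'n \<Rightarrow> int" and k
  assume "(\<Sum>i\<in>UNIV. of_int (u i) *\<^sub>R G $ i) = (\<Sum>i\<in>UNIV. of_int (v i) *\<^sub>R G $ i)"
  then have "(\<Sum>i\<in>UNIV. of_int (u i) *\<^sub>R G $ i) \<bullet> dual_gen G $ k =
      (\<Sum>i\<in>UNIV. of_int (v i) *\<^sub>R G $ i) \<bullet> dual_gen G $ k" by (rule arg_cong)
  then show "u k = v k" unfolding inner_lattice_dual_gen[OF assms] by simp
qed

lemma summable_on_lattice:
  fixes G :: "real^'n^'n"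
  assumes G: "invertible G" and e: "e > 0"
  shows "(\<lambda>x. exp (- e * (norm x)\<^sup>2)) summable_on lattice G"
  unfolding lattice_eq_range summable_on_reindex[OF inj_lattice_param[OF G]]
  using summable_on_lattice_gaussian[OF finite e, of UNIV "\<lambda>i. G $ i" "\<lambda>i. dual_gen G $ i" "\<lambda>_. 0"]
  by (simp add: inner_dual_gen[OF G] o_def)

lemma zero_in_lattice: "0 \<in> lattice G"
  unfolding lattice_def by (auto intro!: exI[of _ 0])

text \<open>A nonzero lattice vector has a nonzero integer coordinate, which is its inner product
  with a dual row; Cauchy-Schwarz then bounds the norm below.\<close>

lemma lattice_norm_lower_bound:
  fixes G :: "real^'n^'n"
  assumes G: "invertible G"
  obtains r where "r > 0" "\<And>x. x \<in> lattice G \<Longrightarrow> x \<noteq> 0 \<Longrightarrow> r \<le> norm x"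
proof
  define N where "N = (\<Sum>k\<in>UNIV. norm (dual_gen G $ k)) + 1"
  have N: "N > 0" "norm (dual_gen G $ k) \<le> N" for k
    using member_le_sum[of k UNIV "\<lambda>k. norm (dual_gen G $ k)"]
    by (auto simp: N_def add_nonneg_pos sum_nonneg)
  show "1 / N > 0" using N(1) by simp
  fix x assume x: "x \<in> lattice G" "x \<noteq> 0"
  then obtain u :: "'n \<Rightarrow> int" where u: "x = (\<Sum>i\<in>UNIV. of_int (u i) *\<^sub>R G $ i)"
    unfolding lattice_eq_range by auto
  with x(2) obtain k where "u k \<noteq> 0" by fastforce
  then have "1 \<le> \<bar>x \<bullet> dual_gen G $ k\<bar>"
    unfolding u inner_lattice_dual_gen[OF G] by linarith
  also have "\<dots> \<le> norm x * norm (dual_gen G $ k)" by (rule Cauchy_Schwarz_ineq2)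
  also have "\<dots> \<le> norm x * N" using N(2) by (rule mult_left_mono) simp
  finally show "1 / N \<le> norm x" using N(1) by (simp add: field_simps)
qed

section \<open>Analytic properties of theta series\<close>

text \<open>Needs no convergence: taking real parts shows that both families are summable or neither
  is, and a divergent \<open>infsum\<close> is 0 by convention.\<close>

lemma infsum_complex_of_real:
  "(\<Sum>\<^sub>\<infinity>x\<in>A. complex_of_real (f x)) = of_real (infsum f A)"
proof (cases "f summable_on A")
  case True
  then show ?thesis by (intro infsumI has_sum_of_real has_sum_infsum)
next
  case False
  then have "\<not> (\<lambda>x. complex_of_real (f x)) summable_on A"
    using summable_on_Re by fastforce
  with False show ?thesis by (simp add: infsum_not_exists)
qed

lemma theta_imaginary_axis:
  fixes L :: "(real^'n) set"
  shows "theta L (\<i> * of_real t) = of_real (\<Sum>\<^sub>\<infinity>x\<in>L. exp (- (pi * t) * (norm x)\<^sup>2))"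
proof -
  have "exp (\<i> * of_real pi * (\<i> * of_real t) * of_real ((norm x)\<^sup>2)) =
      complex_of_real (exp (- (pi * t) * (norm x)\<^sup>2))" for x :: "real^'n"
    by (simp flip: exp_of_real) (simp add: algebra_simps)
  then show ?thesis by (simp only: theta_def infsum_complex_of_real)
qed

text \<open>On the imaginary axis all terms are positive, and the origin alone contributes
  1.\<close>

lemma theta_lattice_nonzero:
  fixes G :: "real^'n^'n"
  assumes "invertible G" "t > 0"
  shows "theta (lattice G) (\<i> * of_real t) \<noteq> 0"
proof -
  let ?f = "\<lambda>x :: real^'n. exp (- (pi * t) * (norm x)\<^sup>2)"
  have "sum ?f {0} \<le> infsum ?f (lattice G)"
    using summable_on_lattice[OF assms(1), of "pi * t"] zero_in_lattice[of G] assms(2)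
    by (intro finite_sum_le_infsum) auto
  then show ?thesis unfolding theta_imaginary_axis by simp
qed

text \<open>Only the origin survives: nonzero vectors have norm at least \<open>r\<close>, so for
  \<open>t \<ge> 1\<close> their total is at most \<open>exp (- (pi * r^2) * (t - 1))\<close> times
  the total at \<open>t = 1\<close>.\<close>

lemma theta_lattice_tendsto_1:
  fixes G :: "real^'n^'n"
  assumes G: "invertible G"
  shows "((\<lambda>t. theta (lattice G) (\<i> * of_real t)) \<longlongrightarrow> 1) at_top"
proof -
  obtain r where r: "r > 0" "\<And>x. x \<in> lattice G \<Longrightarrow> x \<noteq> 0 \<Longrightarrow> r \<le> norm x"
    using lattice_norm_lower_bound[OF G] by blast
  let ?f = "\<lambda>t (x :: real^'n). exp (- (pi * t) * (norm x)\<^sup>2)"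
  define S where "S = infsum (?f 1) (lattice G - {0})"
  define q where "q t = exp (- (pi * r\<^sup>2) * (t - 1))" for t :: real
  have summ: "?f t summable_on (lattice G - {0})" if "t > 0" for t
    by (rule summable_on_subset[OF summable_on_lattice[OF G]]) (use that in auto)
  have split: "infsum (?f t) (lattice G) = 1 + infsum (?f t) (lattice G - {0})" if "t > 0" for t
    using infsum_insert[OF summ[OF that], of 0] zero_in_lattice[of G] by (simp add: insert_absorb)
  have upper: "infsum (?f t) (lattice G - {0}) \<le> q t * S" if t: "t \<ge> 1" for t
    unfolding S_def infsum_cmult_right'[symmetric]
  proof (rule infsum_mono)
    show "?f t summable_on (lattice G - {0})" using t by (intro summ) auto
    show "(\<lambda>x. q t * ?f 1 x) summable_on (lattice G - {0})"
      using summ[of 1] by (intro summable_on_cmult_right) auto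
    fix x assume x: "x \<in> lattice G - {0}"
    then have "r\<^sup>2 \<le> (norm x)\<^sup>2" using r by (intro power_mono) auto
    then have "(pi * (t - 1)) * r\<^sup>2 \<le> (pi * (t - 1)) * (norm x)\<^sup>2"
      using t by (intro mult_left_mono) auto
    then show "?f t x \<le> q t * ?f 1 x"
      by (simp add: q_def algebra_simps flip: exp_add)
  qed
  have "(q \<longlongrightarrow> 0) at_top"
    unfolding q_def using r(1) by real_asymp
  then have lim: "((\<lambda>t. q t * S) \<longlongrightarrow> 0) at_top"
    by (rule tendsto_mult_left_zero)
  have "\<forall>\<^sub>F t in at_top. infsum (?f t) (lattice G - {0}) \<le> q t * S"
    using eventually_ge_at_top[of 1] by eventually_elim (rule upper)
  moreover have "\<forall>\<^sub>F t in at_top. 0 \<le> infsum (?f t) (lattice G - {0})"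
    by (intro always_eventually allI infsum_nonneg) simp
  ultimately have "((\<lambda>t. infsum (?f t) (lattice G - {0})) \<longlongrightarrow> 0) at_top"
    by (intro tendsto_sandwich[OF _ _ tendsto_const lim])
  then have "((\<lambda>t. 1 + infsum (?f t) (lattice G - {0})) \<longlongrightarrow> 1 + 0) at_top"
    by (intro tendsto_intros)
  moreover have "\<forall>\<^sub>F t in at_top. 1 + infsum (?f t) (lattice G - {0}) = infsum (?f t) (lattice G)"
    using eventually_gt_at_top[of 0] by eventually_elim (rule split[symmetric])
  ultimately have "((\<lambda>t. infsum (?f t) (lattice G)) \<longlongrightarrow> 1 + 0) at_top"
    by (rule Lim_transform_eventually)
  from tendsto_of_real[OF this] show ?thesis
    unfolding theta_imaginary_axis by simp
qed

lemma theta_lattice_holomorphic: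
  fixes G :: "real^'n^'n"
  assumes G: "invertible G"
  shows "theta (lattice G) holomorphic_on {z. Im z > 0}"
proof -
  let ?g = "\<lambda>(x :: real^'n) z. exp (\<i> * of_real pi * z * of_real ((norm x)\<^sup>2))"
  have "theta (lattice G) field_differentiable at w" if w: "Im w > 0" for w
  proof -
    \<comment> \<open>The closed disc of this radius stays at height at least \<open>r\<close>, so
      the Gaussian with parameter \<open>pi * r\<close> majorises all terms there.\<close>
    define r where "r = Im w / 2"
    have r: "r > 0" using w by (simp add: r_def)
    have bound: "norm (?g x z) \<le> exp (- (pi * r) * (norm x)\<^sup>2)" if "z \<in> cball w r" for x :: "real^'n" and z
    proof -
      have "\<bar>Im (w - z)\<bar> \<le> r" using that abs_Im_le_cmod[of "w - z"] by (simp add: dist_norm)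
      then have "r \<le> Im z" unfolding r_def minus_complex.sel by linarith
      then have "(pi * r) * (norm x)\<^sup>2 \<le> (pi * Im z) * (norm x)\<^sup>2"
        by (intro mult_right_mono mult_left_mono) auto
      then show ?thesis by (simp add: norm_exp_eq_Re)
    qed
    have ul: "uniform_limit (cball w r) (\<lambda>X z. \<Sum>x\<in>X. ?g x z) (theta (lattice G)) (finite_subsets_at_top (lattice G))"
      unfolding theta_def
      by (rule Weierstrass_m_test_general[OF bound summable_on_lattice[OF G]]) (use r in auto)
    have "theta (lattice G) holomorphic_on ball w r"
      by (rule holomorphic_uniform_limit[OF _ ul])
        (auto intro!: always_eventually continuous_intros holomorphic_intros)
    then show ?thesis using r
      by (auto intro: holomorphic_on_imp_differentiable_at)
  qed
  then show ?thesis
    by (auto simp: holomorphic_on_def intro: field_differentiable_at_within)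
qed

section \<open>Functional equation and symmetry of the secrecy function\<close>

text \<open>Lattice Poisson summation for the trivial character, with the rows of \<open>G\<close>
  and of \<open>dual_gen G\<close> as dual families. The constant stays existential, since limits at
  infinity or the value at \<open>t = 1\<close> determine it where needed.\<close>

lemma theta_lattice_functional_equation:
  fixes G :: "real^'n^'n"
  assumes G: "invertible G"
  shows "\<exists>C>0. \<forall>t>0. theta (lattice G) (\<i> * of_real t) =
    of_real (C / sqrt t ^ CARD('n)) * theta (lattice (dual_gen G)) (\<i> * of_real (1 / t))"
proof -
  \<comment> \<open>The rows of an invertible matrix span the space, so such an \<open>x\<close> is
    zero.\<close>
  have perp: "x \<bullet> dual_gen G $ k = 0" if x: "\<And>i. i \<in> UNIV \<Longrightarrow> x \<bullet> G $ i = 0" for x k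
  proof -
    have "G *v x = 0"
      using x by (simp add: vec_eq_iff matrix_vector_mult_def inner_vec_def mult.commute)
    then have "(matrix_inv G ** G) *v x = 0" by (simp flip: matrix_vector_mul_assoc)
    then show ?thesis by (simp add: matrix_inv_left_eq[OF G])
  qed
  have *: "(\<Sum>\<^sub>\<infinity>u. complex_of_real (exp (- s * (norm (\<Sum>i\<in>UNIV. of_int (u i) *\<^sub>R H $ i))\<^sup>2))) =
      of_real (\<Sum>\<^sub>\<infinity>x\<in>lattice H. exp (- s * (norm x)\<^sup>2))" if "invertible H" for s and H :: "real^'n^'n"
    unfolding lattice_eq_range infsum_reindex[OF inj_lattice_param[OF that]] infsum_complex_of_real[symmetric] o_def ..
  obtain C where C: "C > 0" and eq: "\<And>t c. t > 0 \<Longrightarrow>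
    (\<Sum>\<^sub>\<infinity>u\<in>Pi\<^sub>E UNIV (\<lambda>_. UNIV :: int set).
      of_real (exp (- (pi * t) * (norm (\<Sum>i\<in>UNIV. of_int (u i) *\<^sub>R G $ i))\<^sup>2)) *
      cis (2 * pi * (\<Sum>i\<in>UNIV. of_int (u i) * c i))) =
    of_real (C / sqrt t ^ CARD('n)) *
    (\<Sum>\<^sub>\<infinity>w\<in>Pi\<^sub>E UNIV (\<lambda>_. UNIV :: int set).
      complex_of_real (exp (- (pi / t) * (norm (\<Sum>i\<in>UNIV. (of_int (w i) + c i) *\<^sub>R dual_gen G $ i))\<^sup>2)))"
    using poisson_summation_lattice_gaussian[where I = UNIV and b = "\<lambda>i. G $ i" and d = "\<lambda>i. dual_gen G $ i",
        OF finite inner_dual_gen[OF G] perp] by blast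
  show ?thesis
  proof (intro exI[of _ C] conjI C allI impI)
    fix t :: real
    assume "t > 0"
    from eq[OF this, of "\<lambda>_. 0"] *[OF G, of "pi * t"] *[OF invertible_dual_gen[OF G], of "pi / t"]
    show "theta (lattice G) (\<i> * of_real t) =
      of_real (C / sqrt t ^ CARD('n)) * theta (lattice (dual_gen G)) (\<i> * of_real (1 / t))"
      unfolding theta_imaginary_axis
      by simp
  qed
qed

text \<open>The identity theorem applies because the positive imaginary axis accumulates at its own
  point \<open>\<i>\<close> inside the connected half plane.\<close>

lemma holomorphic_eq_upper_half_plane:
  assumes "f holomorphic_on {z. Im z > 0}" "g holomorphic_on {z. Im z > 0}"
    and eq: "\<And>t. t > 0 \<Longrightarrow> f (\<i> * of_real t) = g (\<i> * of_real t)"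
    and z: "Im z > 0"
  shows "f z = g z"
proof -
  let ?U = "(\<lambda>t. \<i> * complex_of_real t) ` {0<..}"
  have "f z - g z = 0"
  proof (rule analytic_continuation[of "\<lambda>z. f z - g z" "{z. Im z > 0}" ?U \<i>])
    show "(\<lambda>z. f z - g z) holomorphic_on {z. Im z > 0}"
      using assms by (intro holomorphic_intros)
    show "\<i> islimpt ?U"
      unfolding islimpt_approachable
    proof (intro allI impI)
      fix e :: real
      assume e: "e > 0"
      have "dist (\<i> * of_real (1 + e / 2)) \<i> = norm (\<i> * of_real (e / 2))"
        by (simp add: dist_norm algebra_simps)
      then show "\<exists>x'\<in>?U. x' \<noteq> \<i> \<and> dist x' \<i> < e"
        using e by (intro bexI[of _ "\<i> * of_real (1 + e / 2)"]) (auto simp: norm_mult complex_eq_iff)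
    qed
  qed (use eq z in \<open>auto simp: open_halfspace_Im_gt convex_connected convex_halfspace_Im_gt\<close>)
  then show ?thesis by simp
qed

theorem theorem1:
  fixes G :: "real^'n^'n"
  assumes "invertible G"
    and "vol G = 1"
  shows "(\<forall>\<tau>>0. secrecy G \<tau> = secrecy G (1 / \<tau>)) \<longleftrightarrow> formally_unimodular G"
proof -
  let ?I = "mat 1 :: real^'n^'n"
  define P where "P t = theta (lattice ?I) (\<i> * of_real t)" for t
  define Q where "Q t = theta (lattice G) (\<i> * of_real t)" for t
  define Q' where "Q' t = theta (lattice (dual_gen G)) (\<i> * of_real t)" for t
  have I: "invertible ?I" by (auto simp: invertible_def intro!: exI[of _ "mat 1"])
  note G = assms(1) and G' = invertible_dual_gen[OF assms(1)]
  have sec: "secrecy G t = P t / Q t" for t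
    using assms(2) by (simp add: secrecy_def P_def Q_def Let_def)
  have nz: "P t \<noteq> 0" "Q t \<noteq> 0" "Q' t \<noteq> 0" if "t > 0" for t
    unfolding P_def Q_def Q'_def using theta_lattice_nonzero that I G G' by blast+
  obtain C0 where C0: "\<And>t. t > 0 \<Longrightarrow> P t = of_real (C0 / sqrt t ^ CARD('n)) * P (1 / t)"
    using theta_lattice_functional_equation[OF I] unfolding P_def dual_gen_mat_1 by blast
  \<comment> \<open>The integer lattice is its own dual, so its equation at the fixed point
    \<open>t = 1\<close> relates the nonzero value \<open>P 1\<close> to itself.\<close>
  have "C0 = 1" using C0[of 1] nz[of 1] by simp
  obtain C where C: "C > 0" "\<And>t. t > 0 \<Longrightarrow> Q t = of_real (C / sqrt t ^ CARD('n)) * Q' (1 / t)"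
    using theta_lattice_functional_equation[OF G] unfolding Q_def Q'_def by blast
  \<comment> \<open>Both functional equations are used at \<open>1 / t\<close>; their common power
    of \<open>sqrt t\<close> cancels in the quotient.\<close>
  have inv: "secrecy G (1 / t) = P t / (of_real C * Q' t)" if t: "t > 0" for t
    using t C0[of "1 / t"] C(2)[of "1 / t"] \<open>C0 = 1\<close>
    by (simp add: sec real_sqrt_divide power_one_over)
  \<comment> \<open>\<open>C\<close> is the reciprocal of the covolume, but comparing limits identifies it without determinants.\<close>
  have C_eq: "C = 1" if "\<And>t. t > 0 \<Longrightarrow> Q t = of_real C * Q' t"
  proof -
    have Q: "(Q \<longlongrightarrow> 1) at_top" and Q': "(Q' \<longlongrightarrow> 1) at_top"
      unfolding Q_def Q'_def by (rule theta_lattice_tendsto_1[OF G] theta_lattice_tendsto_1[OF G'])+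
    have "((\<lambda>t. of_real C * Q' t) \<longlongrightarrow> of_real C * 1) at_top"
      by (intro tendsto_intros Q')
    moreover have "\<forall>\<^sub>F t in at_top. of_real C * Q' t = Q t"
      using eventually_gt_at_top[of 0] by eventually_elim (simp add: that)
    ultimately have "(Q \<longlongrightarrow> of_real C * 1) at_top" by (rule Lim_transform_eventually)
    from tendsto_unique[OF _ Q this] have "complex_of_real C = 1" by simp
    then show ?thesis by simp
  qed
  show ?thesis
  proof
    assume sym: "\<forall>\<tau>>0. secrecy G \<tau> = secrecy G (1 / \<tau>)"
    have eq: "Q t = of_real C * Q' t" if "t > 0" for t
    proof -
      have "P t / Q t = P t / (of_real C * Q' t)"
        using sym[rule_format, OF that] unfolding inv[OF that] sec[of t] .
      then show ?thesis using nz[OF that] C(1) by (simp add: frac_eq_eq)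
    qed
    then have "Q t = Q' t" if "t > 0" for t
      using that C_eq by simp
    then show "formally_unimodular G"
      unfolding formally_unimodular_def Q_def Q'_def
      using holomorphic_eq_upper_half_plane[OF theta_lattice_holomorphic[OF G] theta_lattice_holomorphic[OF G']]
      by blast
  next
    assume fu: "formally_unimodular G"
    then have QQ': "Q t = Q' t" if "t > 0" for t
      unfolding formally_unimodular_def Q_def Q'_def using that by simp
    have "C = 1" using C(2)[of 1] QQ'[of 1] nz[of 1] by simp
    show "\<forall>\<tau>>0. secrecy G \<tau> = secrecy G (1 / \<tau>)"
    proof (intro allI impI)
      fix t :: real
      assume "t > 0"
      then show "secrecy G t = secrecy G (1 / t)"
        using \<open>C = 1\<close> by (simp only: inv sec[of t] QQ' of_real_1 mult_1_left)
    qed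
  qed
qed

end
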